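(* For all positive integers $c$ and $n$, every weakly $c$-closed graph on $n$ vertices has at most $3^{(c-1)/3} n^2$ maximal cliques.
   Context: All graphs are finite, simple and undirected. Given a graph and a positive integer $c$, a bad pair is a pair of non-adjacent distinct vertices having at least $c$ common neighbors. A graph is weakly $c$-closed if there is an ordering $v_1,\dots,v_n$ of its vertices such that for every $i$, the vertex $v_i$ belongs to no bad pair in the subgraph induced by $\{v_i,v_{i+1},\dots,v_n\}$. A maximal clique is a clique (set of pairwise adjacent vertices) not contained in any strictly larger clique. *)

theory Defs
  imports Complex_Main "HOL-Library.Ramsey"
begin

text \<open>
  A graph is a pair of a finite vertex set and a set of two-element sets of vertices;
  looplessness and symmetry are built in. Cliques are those of \<^theory>\<open>HOL-Library.Ramsey\<close>.
\<close>

definition simple_graph :: "'a set \<Rightarrow> 'a set set \<Rightarrow> bool" where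
  "simple_graph V E \<longleftrightarrow> finite V \<and> E \<subseteq> [V]\<^bsup>2\<^esup>"

definition induced_edges :: "'a set set \<Rightarrow> 'a set \<Rightarrow> 'a set set" where
  "induced_edges E U = {e \<in> E. e \<subseteq> U}"

definition common_neighbors :: "'a set \<Rightarrow> 'a set set \<Rightarrow> 'a \<Rightarrow> 'a \<Rightarrow> 'a set" where
  "common_neighbors V E u w = {x \<in> V. {u, x} \<in> E \<and> {w, x} \<in> E}"

definition bad_pair :: "nat \<Rightarrow> 'a set \<Rightarrow> 'a set set \<Rightarrow> 'a \<Rightarrow> 'a \<Rightarrow> bool" where
  "bad_pair c V E u w \<longleftrightarrow>
     u \<in> V \<and> w \<in> V \<and> u \<noteq> w \<and> {u, w} \<notin> E \<and> c \<le> card (common_neighbors V E u w)"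

text \<open>The list below enumerates the vertices; the entries from position \<open>i\<close> on induce the
  subgraph in which the \<open>i\<close>-th entry must lie in no bad pair.\<close>

definition weakly_closed :: "nat \<Rightarrow> 'a set \<Rightarrow> 'a set set \<Rightarrow> bool" where
  "weakly_closed c V E \<longleftrightarrow>
     (\<exists>vs. distinct vs \<and> set vs = V \<and>
        (\<forall>i < length vs. \<forall>w.
           \<not> bad_pair c (set (drop i vs)) (induced_edges E (set (drop i vs))) (vs ! i) w))"

definition maximal_clique :: "'a set \<Rightarrow> 'a set set \<Rightarrow> 'a set \<Rightarrow> bool" where
  "maximal_clique V E K \<longleftrightarrow>
     K \<subseteq> V \<and> clique K E \<and> \<not> (\<exists>L. L \<subseteq> V \<and> clique L E \<and> K \<subset> L)"

end

theory Submission
  imports Defs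
begin

text \<open>
  Delete the first vertex \<open>v\<close> of the ordering. A maximal clique \<open>K\<close> for which \<open>K - {v}\<close> is still
  maximal in the rest is determined by \<open>K - {v}\<close>. Otherwise \<open>v \<in> K\<close> and some \<open>u\<close> not adjacent to
  \<open>v\<close> is adjacent to all of \<open>K - {v}\<close>, so \<open>K - {v}\<close> is a maximal clique of the common neighbourhood
  of \<open>v\<close> and \<open>u\<close>. This neighbourhood has at most \<open>c - 1\<close> vertices, hence at most \<open>3\<^bsup>(c-1)/3\<^esup>\<close> maximal
  cliques by the Moon--Moser theorem. So each deletion of a vertex from \<open>k\<close> ones costs at most
  \<open>(k - 1) 3\<^bsup>(c-1)/3\<^esup>\<close> maximal cliques.
\<close>

section \<open>Maximal cliques and neighbourhoods\<close>

lemma finite_maximal_cliques: "finite V \<Longrightarrow> finite {K. maximal_clique V E K}"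
  by (rule finite_subset[of _ "Pow V"]) (auto simp: maximal_clique_def)

lemma clique_insert:
  "clique (insert v K) E \<longleftrightarrow> clique K E \<and> (\<forall>w\<in>K. w \<noteq> v \<longrightarrow> {v, w} \<in> E)"
  by (auto simp: clique_def insert_commute)

lemma clique_mono: "clique L E \<Longrightarrow> K \<subseteq> L \<Longrightarrow> clique K E"
  by (auto simp: clique_def)

lemma maximal_cliqueD:
  assumes "maximal_clique V E K" "L \<subseteq> V" "clique L E" "K \<subseteq> L"
  shows "L = K"
  using assms by (auto simp: maximal_clique_def)

text \<open>A clique of \<open>W\<close> properly containing \<open>K - {v}\<close> would, with
  \<open>v\<close> added back, properly contain \<open>K\<close>. Leaving \<open>W\<close> free
  among sets of neighbours of \<open>v\<close> covers both full neighbourhoods and common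
  neighbourhoods.\<close>

lemma maximal_clique_link:
  assumes K: "maximal_clique V E K" and "v \<in> K"
    and W: "W \<subseteq> {w \<in> V. w \<noteq> v \<and> {v, w} \<in> E}" and KW: "K - {v} \<subseteq> W"
  shows "maximal_clique W E (K - {v})"
  unfolding maximal_clique_def
proof (intro conjI notI)
  show "clique (K - {v}) E"
    using K by (auto simp: maximal_clique_def intro: clique_mono)
  assume "\<exists>L. L \<subseteq> W \<and> clique L E \<and> K - {v} \<subset> L"
  then obtain L where L: "L \<subseteq> W" "clique L E" "K - {v} \<subset> L"
    by blast
  have "insert v L = K"
  proof (rule maximal_cliqueD[OF K])
    show "insert v L \<subseteq> V"
      using L W K \<open>v \<in> K\<close> by (auto simp: maximal_clique_def)
    show "clique (insert v L) E"
      using L W by (auto simp: clique_insert)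
  qed (use L in auto)
  then show False
    using L W by auto
qed (fact KW)

section \<open>The Moon--Moser bound\<close>

lemma cube_le_3_power: "k ^ 3 \<le> (3::nat) ^ k"
proof (induction k)
  case (Suc k)
  \<comment> \<open>The growth estimate \<open>Suc k ^ 3 \<le> 3 * k ^ 3\<close> fails for
    \<open>k < 3\<close>, so these cases are computed directly.\<close>
  consider "k = 0" | "k = 1" | "k = 2" | "k \<ge> 3"
    by linarith
  then show ?case
  proof cases
    case 4
    have "3 * k ^ 2 \<le> k ^ 3"
      using 4 by (simp add: power2_eq_square power3_eq_cube)
    moreover have "3 * k \<le> k ^ 2" "9 \<le> k ^ 2"
      using 4 power_mono[OF 4, of 2] by (simp_all add: power2_eq_square)
    moreover have "Suc k ^ 3 = k ^ 3 + 3 * k ^ 2 + 3 * k + 1"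
      by (simp add: power2_eq_square power3_eq_cube algebra_simps)
    ultimately have "Suc k ^ 3 \<le> 3 * k ^ 3"
      using 4 by linarith
    then show ?thesis
      using Suc by simp
  qed (auto simp: power3_eq_cube)
qed simp

text \<open>This is the source of the base: \<open>3 powr (1/3)\<close> is the least
  \<open>a\<close> with \<open>k \<le> a ^ k\<close> for all naturals \<open>k\<close>, with
  equality at \<open>k = 3\<close>.\<close>

lemma le_3_powr_third: "real k \<le> 3 powr (real k / 3)"
\<comment> \<open>The rule compares \<open>Suc n\<close>-th powers, so \<open>n = 2\<close> means
  cubing.\<close>
proof (rule power_le_imp_le_base[where n = 2])
  have "(3 powr (real k / 3)) ^ 3 = 3 powr (real k)"
    by (simp add: powr_power)
  also have "\<dots> = 3 ^ k"
    by (simp add: powr_realpow)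
  finally show "real k ^ Suc 2 \<le> (3 powr (real k / 3)) ^ Suc 2"
    using cube_le_3_power[of k] by (simp add: numeral_3_eq_3 flip: of_nat_le_iff[where 'a = real])
qed simp

text \<open>Induction on \<open>card V\<close>, branching over the vertices that a maximal clique
  can use from one smallest closed non-neighbourhood.\<close>

theorem Moon_Moser:
  assumes "finite V"
  shows "real (card {K. maximal_clique V E K}) \<le> 3 powr (real (card V) / 3)"
  using assms
proof (induction "card V" arbitrary: V rule: less_induct)
  case less
  show ?case
  proof (cases "V = {}")
    case True
    then have "{K. maximal_clique V E K} = {{}}"
      by (auto simp: maximal_clique_def clique_def)
    then show ?thesis
      by (simp add: True)
  next
    case False
    \<comment> \<open>\<open>A u\<close> is the closed neighbourhood of \<open>u\<close> in the
      complement graph, so \<open>V - A u\<close> is the open neighbourhood of \<open>u\<close> in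
      \<open>V\<close>.\<close>
    define A where "A u = {w \<in> V. w = u \<or> {u, w} \<notin> E}" for u
    have finA: "finite (A u)" and AV: "A u \<subseteq> V" for u
      using less.prems by (auto simp: A_def)
    \<comment> \<open>Minimality at \<open>v\<close> gives
      \<open>card (V - A u) \<le> card V - card (A v)\<close> for every branch vertex
      \<open>u\<close>, hence one bound for all branches.\<close>
    obtain v where v: "v \<in> V" and vmin: "\<And>u. u \<in> V \<Longrightarrow> card (A v) \<le> card (A u)"
      using ex_is_arg_min_if_finite[OF less.prems False, of "\<lambda>u. card (A u)"]
      by (auto simp: is_arg_min_linorder)
    let ?k = "card (A v)"
    have kV: "?k \<le> card V"
      using AV less.prems card_mono by blast
    have meets: "\<exists>u \<in> A v. u \<in> K" if K: "maximal_clique V E K" for K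
    proof (rule ccontr)
      assume none: "\<not> ?thesis"
      \<comment> \<open>A \<open>K\<close> missing \<open>A v\<close> consists of neighbours of
        \<open>v\<close> only, so \<open>v\<close> could be added.\<close>
      have "insert v K = K"
        using K v none
        by (intro maximal_cliqueD[OF K]) (auto simp: maximal_clique_def clique_insert A_def)
      then show False
        using none v by (auto simp: A_def)
    qed
    have "{K. maximal_clique V E K} \<subseteq> (\<Union>u\<in>A v. insert u ` {L. maximal_clique (V - A u) E L})"
    proof
      fix K assume "K \<in> {K. maximal_clique V E K}"
      then have K: "maximal_clique V E K"
        by simp
      then obtain u where u: "u \<in> A v" "u \<in> K"
        using meets by blast
      have "maximal_clique (V - A u) E (K - {u})"
      proof (rule maximal_clique_link[OF K u(2)])
        show "K - {u} \<subseteq> V - A u"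
          using K u(2) by (auto simp: A_def maximal_clique_def clique_def)
      qed (auto simp: A_def)
      moreover have "K = insert u (K - {u})"
        using u by auto
      ultimately show "K \<in> (\<Union>u\<in>A v. insert u ` {L. maximal_clique (V - A u) E L})"
        using u by blast
    qed
    then have "card {K. maximal_clique V E K}
        \<le> card (\<Union>u\<in>A v. insert u ` {L. maximal_clique (V - A u) E L})"
      using less.prems finA by (intro card_mono) (auto intro!: finite_maximal_cliques)
    also have "\<dots> \<le> (\<Sum>u\<in>A v. card (insert u ` {L. maximal_clique (V - A u) E L}))"
      by (rule card_UN_le[OF finA])
    also have "\<dots> \<le> (\<Sum>u\<in>A v. card {L. maximal_clique (V - A u) E L})"
      using less.prems by (intro sum_mono card_image_le finite_maximal_cliques) auto
    finally have "real (card {K. maximal_clique V E K})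
        \<le> (\<Sum>u\<in>A v. real (card {L. maximal_clique (V - A u) E L}))"
      by (simp flip: of_nat_sum)
    also have "\<dots> \<le> (\<Sum>u\<in>A v. 3 powr (real (card V - ?k) / 3))"
    proof (rule sum_mono)
      fix u assume "u \<in> A v"
      then have u: "u \<in> V" "u \<in> A u"
        using AV by (auto simp: A_def)
      have card_diff: "card (V - A u) = card V - card (A u)"
        by (rule card_Diff_subset[OF finA AV])
      have "card (V - A u) < card V"
        using u less.prems by (intro psubset_card_mono) auto
      then have "real (card {L. maximal_clique (V - A u) E L}) \<le> 3 powr (real (card (V - A u)) / 3)"
        using less.prems by (intro less.hyps) auto
      also have "\<dots> \<le> 3 powr (real (card V - ?k) / 3)"
        using vmin[OF u(1)] by (simp add: card_diff)
      finally show "real (card {L. maximal_clique (V - A u) E L}) \<le> 3 powr (real (card V - ?k) / 3)" .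
    qed
    also have "\<dots> = real ?k * 3 powr (real (card V - ?k) / 3)"
      by simp
    \<comment> \<open>The number of branches is absorbed into the exponent freed by removing
      \<open>?k\<close> vertices.\<close>
    also have "\<dots> \<le> 3 powr (real ?k / 3) * 3 powr (real (card V - ?k) / 3)"
      by (intro mult_right_mono le_3_powr_third) simp
    also have "\<dots> = 3 powr (real (card V) / 3)"
      using kV by (simp flip: powr_add add_divide_distrib)
    finally show ?thesis .
  qed
qed

section \<open>Deleting one vertex\<close>

lemma card_maximal_cliques_remove_vertex:
  assumes fin: "finite V" and v: "v \<in> V"
    and no_bad: "\<And>w. \<not> bad_pair c V (induced_edges E V) v w"
  shows "real (card {K. maximal_clique V E K})
    \<le> real (card {K. maximal_clique (V - {v}) E K}) + real (card (V - {v})) * 3 powr ((real c - 1) / 3)"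
proof -
  define N where "N u = common_neighbors V E v u - {v}" for u
  define S where "S = {K. maximal_clique V E K \<and> maximal_clique (V - {v}) E (K - {v})}"
  define T where "T = {K. maximal_clique V E K} - S"
  define U where "U = {u \<in> V - {v}. {v, u} \<notin> E}"
  have finN: "finite (N u)" and finU: "finite U" for u
    using fin by (auto simp: N_def U_def common_neighbors_def)
  have cardN: "real (card (N u)) \<le> real c - 1" if "u \<in> U" for u
  proof -
    \<comment> \<open>The edges concerned have both ends in \<open>V\<close>, so they survive in
      \<open>induced_edges E V\<close>, to which \<open>no_bad\<close> refers.\<close>
    have "N u \<subseteq> common_neighbors V (induced_edges E V) v u"
      using that v by (auto simp: N_def U_def common_neighbors_def induced_edges_def)
    then have "card (N u) \<le> card (common_neighbors V (induced_edges E V) v u)"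
      using fin by (intro card_mono) (auto simp: common_neighbors_def)
    also have "\<dots> < c"
      using no_bad[of u] that v by (auto simp: bad_pair_def U_def induced_edges_def)
    finally show ?thesis
      by linarith
  qed
  have "card S \<le> card {K. maximal_clique (V - {v}) E K}"
  proof (rule card_inj_on_le[where f = "\<lambda>K. K - {v}"])
    show "inj_on (\<lambda>K. K - {v}) S"
    proof (rule inj_onI)
      fix K L assume "K \<in> S" "L \<in> S" and eq: "K - {v} = L - {v}"
      then have K: "maximal_clique V E K" and L: "maximal_clique V E L"
        by (auto simp: S_def)
      \<comment> \<open>Sets that agree off \<open>v\<close> are comparable, and comparable maximal
        cliques coincide.\<close>
      have "K \<subseteq> L \<or> L \<subseteq> K"
        using eq by blast
      then show "K = L"
        using maximal_cliqueD[OF K, of L] maximal_cliqueD[OF L, of K] K L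
        by (auto simp: maximal_clique_def)
    qed
  qed (use fin in \<open>auto simp: S_def intro: finite_maximal_cliques\<close>)
  moreover have "real (card T) \<le> real (card (V - {v})) * 3 powr ((real c - 1) / 3)"
  proof -
    have "T \<subseteq> (\<Union>u\<in>U. insert v ` {L. maximal_clique (N u) E L})"
    proof
      fix K assume "K \<in> T"
      then have K: "maximal_clique V E K" and not_max: "\<not> maximal_clique (V - {v}) E (K - {v})"
        by (auto simp: T_def S_def)
      have KV: "K \<subseteq> V" and K_clique: "clique K E"
        using K by (auto simp: maximal_clique_def)
      obtain L where L: "L \<subseteq> V - {v}" "clique L E" "K - {v} \<subset> L"
        using not_max KV clique_mono[OF K_clique, of "K - {v}"]
        by (auto simp: maximal_clique_def)
      \<comment> \<open>Otherwise \<open>K - {v}\<close> is \<open>K\<close>, and \<open>L\<close>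
        extends it.\<close>
      have vK: "v \<in> K"
        using maximal_cliqueD[OF K, of L] L by auto
      obtain u where u: "u \<in> L" "u \<notin> K"
        using L by blast
      \<comment> \<open>Through \<open>L\<close>, \<open>u\<close> is adjacent to all of
        \<open>K - {v}\<close>; adjacency to \<open>v\<close> as well would let \<open>u\<close>
        extend \<open>K\<close>.\<close>
      have "{v, u} \<notin> E"
      proof
        assume "{v, u} \<in> E"
        then have "clique (insert u K) E"
          using K_clique L u by (auto simp: clique_insert clique_def insert_commute)
        then show False
          using maximal_cliqueD[OF K, of "insert u K"] KV L u by auto
      qed
      then have uU: "u \<in> U"
        using u L by (auto simp: U_def)
      have "maximal_clique (N u) E (K - {v})"
      proof (rule maximal_clique_link[OF K vK])
        show "K - {v} \<subseteq> N u"
        proof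
          fix x assume x: "x \<in> K - {v}"
          then have "x \<in> L" "x \<noteq> u"
            using L u by auto
          then have "{u, x} \<in> E"
            using L(2) u(1) by (auto simp: clique_def)
          moreover have "{v, x} \<in> E"
            using K_clique vK x by (auto simp: clique_def)
          ultimately show "x \<in> N u"
            using x KV by (auto simp: N_def common_neighbors_def)
        qed
      qed (auto simp: N_def common_neighbors_def)
      moreover have "K = insert v (K - {v})"
        using vK by auto
      ultimately show "K \<in> (\<Union>u\<in>U. insert v ` {L. maximal_clique (N u) E L})"
        using uU by blast
    qed
    then have "card T \<le> card (\<Union>u\<in>U. insert v ` {L. maximal_clique (N u) E L})"
      using finU finN by (intro card_mono) (auto intro!: finite_maximal_cliques)
    also have "\<dots> \<le> (\<Sum>u\<in>U. card (insert v ` {L. maximal_clique (N u) E L}))"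
      by (rule card_UN_le[OF finU])
    also have "\<dots> \<le> (\<Sum>u\<in>U. card {L. maximal_clique (N u) E L})"
      by (intro sum_mono card_image_le finite_maximal_cliques finN)
    finally have "real (card T) \<le> (\<Sum>u\<in>U. real (card {L. maximal_clique (N u) E L}))"
      by (simp flip: of_nat_sum)
    also have "\<dots> \<le> (\<Sum>u\<in>U. 3 powr ((real c - 1) / 3))"
    proof (rule sum_mono)
      fix u assume "u \<in> U"
      have "real (card {L. maximal_clique (N u) E L}) \<le> 3 powr (real (card (N u)) / 3)"
        by (rule Moon_Moser[OF finN])
      also have "\<dots> \<le> 3 powr ((real c - 1) / 3)"
        using cardN[OF \<open>u \<in> U\<close>] by simp
      finally show "real (card {L. maximal_clique (N u) E L}) \<le> 3 powr ((real c - 1) / 3)" .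
    qed
    also have "\<dots> = real (card U) * 3 powr ((real c - 1) / 3)"
      by simp
    also have "\<dots> \<le> real (card (V - {v})) * 3 powr ((real c - 1) / 3)"
      using fin by (intro mult_right_mono of_nat_mono card_mono) (auto simp: U_def)
    finally show ?thesis .
  qed
  moreover have "card {K. maximal_clique V E K} = card S + card T"
  proof -
    have S: "S \<subseteq> {K. maximal_clique V E K}"
      by (auto simp: S_def)
    show ?thesis
      using card_Diff_subset[OF finite_subset[OF S] S] card_mono[OF _ S] finite_maximal_cliques[OF fin, of E]
      by (simp add: T_def)
  qed
  ultimately show ?thesis
    by simp
qed

section \<open>Summation along the ordering\<close>

lemma card_maximal_cliques_elimination_order:
  assumes "c > 0" and "distinct vs"
    and "\<And>i w. i < length vs \<Longrightarrow>
      \<not> bad_pair c (set (drop i vs)) (induced_edges E (set (drop i vs))) (vs ! i) w"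
  shows "real (card {K. maximal_clique (set vs) E K})
    \<le> 3 powr ((real c - 1) / 3) * (1 + real (length vs choose 2))"
  using assms(2,3)
proof (induction vs)
  case Nil
  have "{K. maximal_clique {} E K} = {{}}"
    by (auto simp: maximal_clique_def clique_def)
  \<comment> \<open>The empty set is the one maximal clique; \<open>c > 0\<close> makes the exponent
    nonnegative, so the factor is at least 1.\<close>
  then show ?case
    using \<open>c > 0\<close> by (simp add: ge_one_powr_ge_zero binomial_eq_0)
next
  case (Cons v vs)
  let ?M = "3 powr ((real c - 1) / 3)"
  have del: "set (v # vs) - {v} = set vs" and len: "card (set vs) = length vs"
    using Cons.prems(1) by (auto simp: distinct_card)
  have "real (card {K. maximal_clique (set (v # vs)) E K})
      \<le> real (card {K. maximal_clique (set vs) E K}) + real (length vs) * ?M"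
  proof -
    have "\<not> bad_pair c (set (v # vs)) (induced_edges E (set (v # vs))) v w" for w
      using Cons.prems(2)[of 0 w] by simp
    from card_maximal_cliques_remove_vertex[OF _ _ this, unfolded del len]
    show ?thesis
      by simp
  qed
  also have "real (card {K. maximal_clique (set vs) E K}) \<le> ?M * (1 + real (length vs choose 2))"
  proof (rule Cons.IH)
    show "\<not> bad_pair c (set (drop i vs)) (induced_edges E (set (drop i vs))) (vs ! i) w"
      if "i < length vs" for i w
      \<comment> \<open>Position \<open>i\<close> of \<open>vs\<close> is position
        \<open>Suc i\<close> of \<open>v # vs\<close>, with the same suffix.\<close>
      using Cons.prems(2)[of "Suc i" w] that by simp
  qed (use Cons.prems in simp)
  \<comment> \<open>Pascal's rule: \<open>Suc k choose 2\<close> is \<open>k + (k choose 2)\<close>,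
    so the costs \<open>0, 1, 2, ...\<close> add up to the binomial.\<close>
  finally show ?case
    by (simp add: numeral_2_eq_2 algebra_simps)
qed

theorem theorem1p2:
  fixes c n :: nat
    and V :: "'a set"
    and E :: "'a set set"
  assumes "c > 0"
    and "n > 0"
    and "simple_graph V E"
    and "card V = n"
    and "weakly_closed c V E"
  shows "real (card {K. maximal_clique V E K}) \<le> 3 powr ((real c - 1) / 3) * real n ^ 2"
proof -
  obtain vs where vs: "distinct vs" "set vs = V"
    and no_bad: "\<And>i w. i < length vs \<Longrightarrow>
      \<not> bad_pair c (set (drop i vs)) (induced_edges E (set (drop i vs))) (vs ! i) w"
    using \<open>weakly_closed c V E\<close> unfolding weakly_closed_def by blast
  have "length vs = n"
    using distinct_card[OF vs(1)] vs(2) \<open>card V = n\<close> by simp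
  then have "real (card {K. maximal_clique V E K})
      \<le> 3 powr ((real c - 1) / 3) * (1 + real (n choose 2))"
    using card_maximal_cliques_elimination_order[OF \<open>c > 0\<close> vs(1) no_bad] vs(2) by simp
  also have "\<dots> \<le> 3 powr ((real c - 1) / 3) * real n ^ 2"
  proof (rule mult_left_mono)
    \<comment> \<open>Positivity of \<open>n\<close> matters: at \<open>n = 0\<close> the inequality
      would read \<open>1 \<le> 0\<close>.\<close>
    obtain m where m: "n = Suc m"
      using \<open>n > 0\<close> gr0_implies_Suc by blast
    have "1 + (n choose 2) \<le> n ^ 2"
      unfolding m choose_two by (simp add: power2_eq_square)
    then show "1 + real (n choose 2) \<le> real n ^ 2"
      by (simp flip: of_nat_power of_nat_Suc)
  qed simp
  finally show ?thesis .
qed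

end
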